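(* Let $\omega^L,\omega^R\in\Omega$ be given. If the relaxation speeds $a^L$ and $a^R$ are large enough to ensure $$v^L-\frac{a^L}{M\rho^L}<v^*<v^R+\frac{a^R}{M\rho^R},$$ $$e^L+\frac{(\pi^{L*})^2-(\pi^L)^2}{2a^Lb^L}+\frac{M^2\big[(v^*-u^{L*})^2-(v^L-u^L)^2\big]}{2\left(\frac{a^L}{b^L}-1\right)}>0,$$ $$e^R+\frac{(\pi^{R*})^2-(\pi^R)^2}{2a^Rb^R}+\frac{M^2\big[(v^*-u^{R*})^2-(v^R-u^R)^2\big]}{2\left(\frac{a^R}{b^R}-1\right)}>0,$$ then the approximate Riemann solver $W_{\mathcal R}$ preserves the positivity of the density and of the internal energy, i.e. $\rho^{L*},\rho^{R*}>0$ and $e^{L*},e^{R*}>0$.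
   Context: $\Omega=\{\omega=(\rho,\rho u,E):\rho>0,e>0\}$ with $E=\rho e+\frac12M^2\rho u^2$, $M>0$ the Mach number, $\tau=1/\rho$, and pressure law $p=p(\tau,e)$. Given $\omega^L,\omega^R\in\Omega$ and gravitational potential values $\Phi^L,\Phi^R$, put (relaxation equilibrium) $\pi^\alpha=p(\tau^\alpha,e^\alpha)$, $v^\alpha=u^\alpha$, $Z^\alpha=\Phi^\alpha$ for $\alpha\in\{L,R\}$; the relaxation speeds satisfy $a^\alpha,b^\alpha>0$, $a^\alpha\ge b^\alpha$. A state is $W=(\rho,\rho u,E,\rho\pi,\rho v,\rho Z,a,b)$, and $\bar\rho(W^L,W^R)$ is a density average with $\bar\rho=\rho$ if $\rho^L=\rho^R=\rho$. Approximate Riemann solver. With $\Delta=\bar\rho(W^L,W^R)\,(Z^R-Z^L)$, the intermediate states are $v^*=\frac{Mb^Lv^L+Mb^Rv^R+\pi^L-\pi^R-\Delta}{M(b^L+b^R)}$, $\frac1{\rho^{L*}}=\frac1{\rho^L}+\frac{Mb^R(v^R-v^L)+\pi^L-\pi^R-\Delta}{a^L(b^L+b^R)}$, $\frac1{\rho^{R*}}=\frac1{\rho^R}+\frac{Mb^L(v^R-v^L)+\pi^R-\pi^L+\Delta}{a^R(b^L+b^R)}$, $u^{L*}=u^L+\frac{b^L(Mb^R(v^R-v^L)+\pi^L-\pi^R-\Delta)}{Ma^L(b^L+b^R)}$, $u^{R*}=u^R+\frac{b^R(Mb^L(v^L-v^R)+\pi^L-\pi^R-\Delta)}{Ma^R(b^L+b^R)}$,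 $\pi^{L*}=\frac{b^R\pi^L+b^L\pi^R+Mb^Lb^R(v^L-v^R)+b^L\Delta}{b^L+b^R}$, $\pi^{R*}=\frac{b^R\pi^L+b^L\pi^R+Mb^Lb^R(v^L-v^R)-b^R\Delta}{b^L+b^R}$, $e^{\alpha*}=e^\alpha+\frac{(\pi^{\alpha*})^2-(\pi^\alpha)^2}{2a^\alpha b^\alpha}+\frac{M^2[(v^*-u^{\alpha*})^2-(v^\alpha-u^\alpha)^2]}{2(a^\alpha/b^\alpha-1)}$ (last quotient read as $0$ if $a^\alpha=b^\alpha$). $W_{\mathcal R}(x/t;W^L,W^R)$ equals $W^L$, $W^{L*}$, $W^{R*}$, $W^R$ respectively in the four regions separated by the speeds $v^L-\frac{a^L}{M\rho^L}$, $v^*$, $v^R+\frac{a^R}{M\rho^R}$. *)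

theory Defs
  imports Complex_Main
begin

text \<open>
  Physically admissible Euler states \<open>(\<rho>, \<rho>u, E)\<close>, for Mach number \<open>M\<close>.
\<close>

definition Omega :: "real \<Rightarrow> (real \<times> real \<times> real) set" where
  "Omega M = {(\<rho>, \<rho> * u, \<rho> * e + 1/2 * M\<^sup>2 * \<rho> * u\<^sup>2) | \<rho> u e. \<rho> > 0 \<and> e > 0}"

text \<open>
  The relaxation state \<open>W = (\<rho>, \<rho>u, E, \<rho>\<pi>, \<rho>v, \<rho>Z, a, b)\<close> is stored in conserved variables;
  the primitive variables \<open>u, e, \<pi>, v, Z\<close> are recovered by dividing by the density and are
  meaningful only if the density is nonzero.
\<close>

record state =
  st_rho :: real
  st_rhou :: real
  st_E :: real
  st_rhopi :: real
  st_rhov :: real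
  st_rhoZ :: real
  st_a :: real
  st_b :: real

definition vel_u :: "state \<Rightarrow> real" where
  "vel_u W = st_rhou W / st_rho W"

definition int_energy :: "real \<Rightarrow> state \<Rightarrow> real" where
  "int_energy M W = (st_E W - 1/2 * M\<^sup>2 * st_rho W * (vel_u W)\<^sup>2) / st_rho W"

definition pres_pi :: "state \<Rightarrow> real" where
  "pres_pi W = st_rhopi W / st_rho W"

definition vel_v :: "state \<Rightarrow> real" where
  "vel_v W = st_rhov W / st_rho W"

definition pot_Z :: "state \<Rightarrow> real" where
  "pot_Z W = st_rhoZ W / st_rho W"

definition mk_state ::
  "real \<Rightarrow> real \<Rightarrow> real \<Rightarrow> real \<Rightarrow> real \<Rightarrow> real \<Rightarrow> real \<Rightarrow> real \<Rightarrow> real \<Rightarrow> state" where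
  "mk_state M \<rho> u e \<pi> v Z a b =
     \<lparr> st_rho = \<rho>, st_rhou = \<rho> * u, st_E = \<rho> * e + 1/2 * M\<^sup>2 * \<rho> * u\<^sup>2,
       st_rhopi = \<rho> * \<pi>, st_rhov = \<rho> * v, st_rhoZ = \<rho> * Z, st_a = a, st_b = b \<rparr>"

text \<open>
  Relaxation equilibrium \<open>\<pi> = p(\<tau>, e)\<close>, \<open>v = u\<close>, \<open>Z = \<Phi>\<close>, where \<open>\<tau> = 1/\<rho>\<close>.
\<close>

definition equilibrium_state ::
  "real \<Rightarrow> (real \<Rightarrow> real \<Rightarrow> real) \<Rightarrow> real \<times> real \<times> real \<Rightarrow> real \<Rightarrow> real \<Rightarrow> real \<Rightarrow> state" where
  "equilibrium_state M p \<omega> \<Phi> a b =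
     (case \<omega> of (\<rho>, m, E) \<Rightarrow>
        let u = m / \<rho>; e = (E - 1/2 * M\<^sup>2 * \<rho> * u\<^sup>2) / \<rho>
        in mk_state M \<rho> u e (p (1 / \<rho>) e) u \<Phi> a b)"

definition density_average :: "(state \<Rightarrow> state \<Rightarrow> real) \<Rightarrow> bool" where
  "density_average \<rho>bar \<longleftrightarrow>
     (\<forall>W1 W2 \<rho>. 0 < \<rho> \<and> st_rho W1 = \<rho> \<and> st_rho W2 = \<rho> \<longrightarrow> \<rho>bar W1 W2 = \<rho>)"

definition source_jump :: "(state \<Rightarrow> state \<Rightarrow> real) \<Rightarrow> state \<Rightarrow> state \<Rightarrow> real" where
  "source_jump \<rho>bar WL WR = \<rho>bar WL WR * (pot_Z WR - pot_Z WL)"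

definition v_star :: "real \<Rightarrow> (state \<Rightarrow> state \<Rightarrow> real) \<Rightarrow> state \<Rightarrow> state \<Rightarrow> real" where
  "v_star M \<rho>bar WL WR =
     (M * st_b WL * vel_v WL + M * st_b WR * vel_v WR + pres_pi WL - pres_pi WR
        - source_jump \<rho>bar WL WR)
     / (M * (st_b WL + st_b WR))"

definition rho_Lstar :: "real \<Rightarrow> (state \<Rightarrow> state \<Rightarrow> real) \<Rightarrow> state \<Rightarrow> state \<Rightarrow> real" where
  "rho_Lstar M \<rho>bar WL WR =
     1 / (1 / st_rho WL
          + (M * st_b WR * (vel_v WR - vel_v WL) + pres_pi WL - pres_pi WR
               - source_jump \<rho>bar WL WR)
            / (st_a WL * (st_b WL + st_b WR)))"

definition rho_Rstar :: "real \<Rightarrow> (state \<Rightarrow> state \<Rightarrow> real) \<Rightarrow> state \<Rightarrow> state \<Rightarrow> real" where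
  "rho_Rstar M \<rho>bar WL WR =
     1 / (1 / st_rho WR
          + (M * st_b WL * (vel_v WR - vel_v WL) + pres_pi WR - pres_pi WL
               + source_jump \<rho>bar WL WR)
            / (st_a WR * (st_b WL + st_b WR)))"

definition u_Lstar :: "real \<Rightarrow> (state \<Rightarrow> state \<Rightarrow> real) \<Rightarrow> state \<Rightarrow> state \<Rightarrow> real" where
  "u_Lstar M \<rho>bar WL WR =
     vel_u WL
     + st_b WL * (M * st_b WR * (vel_v WR - vel_v WL) + pres_pi WL - pres_pi WR
                    - source_jump \<rho>bar WL WR)
       / (M * st_a WL * (st_b WL + st_b WR))"

definition u_Rstar :: "real \<Rightarrow> (state \<Rightarrow> state \<Rightarrow> real) \<Rightarrow> state \<Rightarrow> state \<Rightarrow> real" where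
  "u_Rstar M \<rho>bar WL WR =
     vel_u WR
     + st_b WR * (M * st_b WL * (vel_v WL - vel_v WR) + pres_pi WL - pres_pi WR
                    - source_jump \<rho>bar WL WR)
       / (M * st_a WR * (st_b WL + st_b WR))"

definition pi_Lstar :: "real \<Rightarrow> (state \<Rightarrow> state \<Rightarrow> real) \<Rightarrow> state \<Rightarrow> state \<Rightarrow> real" where
  "pi_Lstar M \<rho>bar WL WR =
     (st_b WR * pres_pi WL + st_b WL * pres_pi WR
        + M * st_b WL * st_b WR * (vel_v WL - vel_v WR)
        + st_b WL * source_jump \<rho>bar WL WR)
     / (st_b WL + st_b WR)"

definition pi_Rstar :: "real \<Rightarrow> (state \<Rightarrow> state \<Rightarrow> real) \<Rightarrow> state \<Rightarrow> state \<Rightarrow> real" where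
  "pi_Rstar M \<rho>bar WL WR =
     (st_b WR * pres_pi WL + st_b WL * pres_pi WR
        + M * st_b WL * st_b WR * (vel_v WL - vel_v WR)
        - st_b WR * source_jump \<rho>bar WL WR)
     / (st_b WL + st_b WR)"

definition e_Lstar :: "real \<Rightarrow> (state \<Rightarrow> state \<Rightarrow> real) \<Rightarrow> state \<Rightarrow> state \<Rightarrow> real" where
  "e_Lstar M \<rho>bar WL WR =
     int_energy M WL
     + ((pi_Lstar M \<rho>bar WL WR)\<^sup>2 - (pres_pi WL)\<^sup>2) / (2 * st_a WL * st_b WL)
     + (if st_a WL = st_b WL then 0
        else M\<^sup>2 * ((v_star M \<rho>bar WL WR - u_Lstar M \<rho>bar WL WR)\<^sup>2 - (vel_v WL - vel_u WL)\<^sup>2)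
             / (2 * (st_a WL / st_b WL - 1)))"

definition e_Rstar :: "real \<Rightarrow> (state \<Rightarrow> state \<Rightarrow> real) \<Rightarrow> state \<Rightarrow> state \<Rightarrow> real" where
  "e_Rstar M \<rho>bar WL WR =
     int_energy M WR
     + ((pi_Rstar M \<rho>bar WL WR)\<^sup>2 - (pres_pi WR)\<^sup>2) / (2 * st_a WR * st_b WR)
     + (if st_a WR = st_b WR then 0
        else M\<^sup>2 * ((v_star M \<rho>bar WL WR - u_Rstar M \<rho>bar WL WR)\<^sup>2 - (vel_v WR - vel_u WR)\<^sup>2)
             / (2 * (st_a WR / st_b WR - 1)))"

text \<open>
  The quantities \<open>Z, a, b\<close> are transported with velocity \<open>v\<close>, hence jump only across the
  contact wave of speed \<open>v*\<close>; both intermediate states carry the relaxation velocity \<open>v*\<close>.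
\<close>

definition W_Lstar :: "real \<Rightarrow> (state \<Rightarrow> state \<Rightarrow> real) \<Rightarrow> state \<Rightarrow> state \<Rightarrow> state" where
  "W_Lstar M \<rho>bar WL WR =
     mk_state M (rho_Lstar M \<rho>bar WL WR) (u_Lstar M \<rho>bar WL WR) (e_Lstar M \<rho>bar WL WR)
       (pi_Lstar M \<rho>bar WL WR) (v_star M \<rho>bar WL WR) (pot_Z WL) (st_a WL) (st_b WL)"

definition W_Rstar :: "real \<Rightarrow> (state \<Rightarrow> state \<Rightarrow> real) \<Rightarrow> state \<Rightarrow> state \<Rightarrow> state" where
  "W_Rstar M \<rho>bar WL WR =
     mk_state M (rho_Rstar M \<rho>bar WL WR) (u_Rstar M \<rho>bar WL WR) (e_Rstar M \<rho>bar WL WR)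
       (pi_Rstar M \<rho>bar WL WR) (v_star M \<rho>bar WL WR) (pot_Z WR) (st_a WR) (st_b WR)"

text \<open>
  The argument \<open>\<xi>\<close> is the self-similar variable \<open>x/t\<close>.  On a discontinuity the right-hand
  value is taken.
\<close>

definition riemann_solver ::
  "real \<Rightarrow> (state \<Rightarrow> state \<Rightarrow> real) \<Rightarrow> real \<Rightarrow> state \<Rightarrow> state \<Rightarrow> state" where
  "riemann_solver M \<rho>bar \<xi> WL WR =
     (if \<xi> < vel_v WL - st_a WL / (M * st_rho WL) then WL
      else if \<xi> < v_star M \<rho>bar WL WR then W_Lstar M \<rho>bar WL WR
      else if \<xi> < vel_v WR + st_a WR / (M * st_rho WR) then W_Rstar M \<rho>bar WL WR
      else WR)"

end

theory Submission
  imports Defs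
begin

text \<open>
  Across the outer waves the Rankine-Hugoniot relations read
  \<open>1/\<rho>\<^sup>L\<^sup>* = 1/\<rho>\<^sup>L + M (v\<^sup>* - v\<^sup>L) / a\<^sup>L\<close> and \<open>1/\<rho>\<^sup>R\<^sup>* = 1/\<rho>\<^sup>R + M (v\<^sup>R - v\<^sup>*) / a\<^sup>R\<close>,
  so the ordering of the wave speeds says exactly that both specific volumes are positive. The
  conditions on the internal energies are the definitions of \<open>e\<^sup>L\<^sup>*\<close> and \<open>e\<^sup>R\<^sup>*\<close> themselves.
\<close>

lemma int_energy_mk_state:
  assumes "\<rho> \<noteq> 0"
  shows "int_energy M (mk_state M \<rho> u e \<pi> v Z a b) = e"
  using assms by (simp add: int_energy_def vel_u_def mk_state_def)

text \<open>Dividing by the positive density recovers the \<open>u\<close> and \<open>e\<close> that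
  parametrize \<open>Omega M\<close>, so an equilibrium state takes the \<open>mk_state\<close> form
  on which \<open>int_energy_mk_state\<close> acts.\<close>

lemma OmegaE_equilibrium:
  assumes "\<omega> \<in> Omega M"
  obtains \<rho> u e where "\<rho> > 0" "e > 0"
    "equilibrium_state M p \<omega> \<Phi> a b = mk_state M \<rho> u e (p (1 / \<rho>) e) u \<Phi> a b"
proof -
  from assms obtain \<rho> u e where \<omega>: "\<omega> = (\<rho>, \<rho> * u, \<rho> * e + 1/2 * M\<^sup>2 * \<rho> * u\<^sup>2)"
    and pos: "\<rho> > 0" "e > 0"
    unfolding Omega_def by blast
  have "equilibrium_state M p \<omega> \<Phi> a b = mk_state M \<rho> u e (p (1 / \<rho>) e) u \<Phi> a b"
    using pos by (simp add: equilibrium_state_def \<omega> Let_def)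
  with pos show thesis by (rule that)
qed

lemma equilibrium_state_admissible:
  assumes "\<omega> \<in> Omega M"
  shows "st_rho (equilibrium_state M p \<omega> \<Phi> a b) > 0"
    and "int_energy M (equilibrium_state M p \<omega> \<Phi> a b) > 0"
proof -
  from assms obtain \<rho> u e where "\<rho> > 0" "e > 0"
    "equilibrium_state M p \<omega> \<Phi> a b = mk_state M \<rho> u e (p (1 / \<rho>) e) u \<Phi> a b"
    by (rule OmegaE_equilibrium)
  then show "st_rho (equilibrium_state M p \<omega> \<Phi> a b) > 0"
    and "int_energy M (equilibrium_state M p \<omega> \<Phi> a b) > 0"
    \<comment> \<open>\<open>mk_state\<close> stays folded until the energy goal is closed; only the
      density goal needs it unfolded.\<close>
    by (simp_all add: int_energy_mk_state) (simp add: mk_state_def)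
qed

lemma equilibrium_state_speeds [simp]:
  "st_a (equilibrium_state M p \<omega> \<Phi> a b) = a"
  "st_b (equilibrium_state M p \<omega> \<Phi> a b) = b"
  by (simp_all add: equilibrium_state_def mk_state_def Let_def split: prod.split)

text \<open>The numerator in \<open>rho_Lstar_def\<close> is \<open>M * (st_b WL + st_b WR)\<close>
  times the jump of \<open>v\<close> across the left wave, so the sum of the \<open>b\<close>
  cancels.\<close>

lemma rho_Lstar_eq:
  assumes "M > 0" "st_a WL > 0" "st_b WL > 0" "st_b WR > 0"
  shows "rho_Lstar M \<rho>bar WL WR
    = 1 / (1 / st_rho WL + M * (v_star M \<rho>bar WL WR - vel_v WL) / st_a WL)"
proof -
  have "st_b WL + st_b WR \<noteq> 0" using assms by linarith
  then show ?thesis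
    unfolding rho_Lstar_def v_star_def
    \<comment> \<open>The outer reciprocal is peeled off first: its denominator is not known to be
      nonzero here, so it must not be cleared.\<close>
    using assms by (intro arg_cong[where f = "\<lambda>x. 1 / (1 / st_rho WL + x)"])
      (simp add: divide_simps, simp add: algebra_simps)
qed

lemma rho_Rstar_eq:
  assumes "M > 0" "st_a WR > 0" "st_b WL > 0" "st_b WR > 0"
  shows "rho_Rstar M \<rho>bar WL WR
    = 1 / (1 / st_rho WR + M * (vel_v WR - v_star M \<rho>bar WL WR) / st_a WR)"
proof -
  have "st_b WL + st_b WR \<noteq> 0" using assms by linarith
  then show ?thesis
    unfolding rho_Rstar_def v_star_def
    using assms by (intro arg_cong[where f = "\<lambda>x. 1 / (1 / st_rho WR + x)"])
      (simp add: divide_simps, simp add: algebra_simps)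
qed

text \<open>Scaling by \<open>M / a\<close> turns the acoustic speed \<open>a / (M * r)\<close> into
  \<open>1 / r\<close>. The jump \<open>d\<close> will be v* - v^L on the left and v^R - v* on the
  right.\<close>

lemma specific_volume_pos:
  fixes M a r d :: real
  assumes "M > 0" "a > 0" "- (a / (M * r)) < d"
  shows "0 < 1 / r + M * d / a"
proof -
  have "M / a * - (a / (M * r)) < M / a * d"
    using assms by (intro mult_strict_left_mono) simp_all
  then show ?thesis using assms by simp
qed

lemma rho_Lstar_pos:
  assumes "M > 0" "st_a WL > 0" "st_b WL > 0" "st_b WR > 0"
    and "vel_v WL - st_a WL / (M * st_rho WL) < v_star M \<rho>bar WL WR"
  shows "rho_Lstar M \<rho>bar WL WR > 0"
  using assms by (simp add: rho_Lstar_eq specific_volume_pos)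

lemma rho_Rstar_pos:
  assumes "M > 0" "st_a WR > 0" "st_b WL > 0" "st_b WR > 0"
    and "v_star M \<rho>bar WL WR < vel_v WR + st_a WR / (M * st_rho WR)"
  shows "rho_Rstar M \<rho>bar WL WR > 0"
  using assms by (simp add: rho_Rstar_eq specific_volume_pos)

text \<open>The solver takes only four values. For the two intermediate ones, positive density also
  ensures that \<open>int_energy\<close> returns the stored \<open>e_Lstar\<close> or
  \<open>e_Rstar\<close>.\<close>

lemma riemann_solver_admissible:
  assumes "st_rho WL > 0" "st_rho WR > 0" "int_energy M WL > 0" "int_energy M WR > 0"
    and "rho_Lstar M \<rho>bar WL WR > 0" "rho_Rstar M \<rho>bar WL WR > 0"
    and "e_Lstar M \<rho>bar WL WR > 0" "e_Rstar M \<rho>bar WL WR > 0"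
  shows "st_rho (riemann_solver M \<rho>bar \<xi> WL WR) > 0"
    and "int_energy M (riemann_solver M \<rho>bar \<xi> WL WR) > 0"
proof -
  have "st_rho (W_Lstar M \<rho>bar WL WR) > 0" "st_rho (W_Rstar M \<rho>bar WL WR) > 0"
    using assms by (simp_all add: W_Lstar_def W_Rstar_def mk_state_def)
  then show "st_rho (riemann_solver M \<rho>bar \<xi> WL WR) > 0"
    using assms by (simp add: riemann_solver_def)
  have "int_energy M (W_Lstar M \<rho>bar WL WR) > 0" "int_energy M (W_Rstar M \<rho>bar WL WR) > 0"
    using assms by (simp_all add: W_Lstar_def W_Rstar_def int_energy_mk_state)
  then show "int_energy M (riemann_solver M \<rho>bar \<xi> WL WR) > 0"
    using assms by (simp add: riemann_solver_def)
qed

theorem lemma6: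
  fixes M :: real
    and p :: "real \<Rightarrow> real \<Rightarrow> real"
    and \<rho>bar :: "state \<Rightarrow> state \<Rightarrow> real"
    and \<omega>L \<omega>R :: "real \<times> real \<times> real"
    and \<Phi>L \<Phi>R aL bL aR bR :: real
    and WL WR :: state
  assumes "M > 0"
    and "density_average \<rho>bar"
    and "\<omega>L \<in> Omega M" and "\<omega>R \<in> Omega M"
    and "aL > 0" and "bL > 0" and "aL \<ge> bL"
    and "aR > 0" and "bR > 0" and "aR \<ge> bR"
    and "WL = equilibrium_state M p \<omega>L \<Phi>L aL bL"
    and "WR = equilibrium_state M p \<omega>R \<Phi>R aR bR"
    and "vel_v WL - aL / (M * st_rho WL) < v_star M \<rho>bar WL WR"
    and "v_star M \<rho>bar WL WR < vel_v WR + aR / (M * st_rho WR)"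
    and "int_energy M WL
           + ((pi_Lstar M \<rho>bar WL WR)\<^sup>2 - (pres_pi WL)\<^sup>2) / (2 * aL * bL)
           + (if aL = bL then 0
              else M\<^sup>2 * ((v_star M \<rho>bar WL WR - u_Lstar M \<rho>bar WL WR)\<^sup>2 - (vel_v WL - vel_u WL)\<^sup>2)
                   / (2 * (aL / bL - 1))) > 0"
    and "int_energy M WR
           + ((pi_Rstar M \<rho>bar WL WR)\<^sup>2 - (pres_pi WR)\<^sup>2) / (2 * aR * bR)
           + (if aR = bR then 0
              else M\<^sup>2 * ((v_star M \<rho>bar WL WR - u_Rstar M \<rho>bar WL WR)\<^sup>2 - (vel_v WR - vel_u WR)\<^sup>2)
                   / (2 * (aR / bR - 1))) > 0"
  shows "rho_Lstar M \<rho>bar WL WR > 0 \<and> rho_Rstar M \<rho>bar WL WR > 0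
       \<and> e_Lstar M \<rho>bar WL WR > 0 \<and> e_Rstar M \<rho>bar WL WR > 0
       \<and> (\<forall>\<xi>. st_rho (riemann_solver M \<rho>bar \<xi> WL WR) > 0
              \<and> int_energy M (riemann_solver M \<rho>bar \<xi> WL WR) > 0)"
proof -
  have speeds: "st_a WL = aL" "st_b WL = bL" "st_a WR = aR" "st_b WR = bR"
    using assms(11,12) by simp_all
  have adm: "st_rho WL > 0" "st_rho WR > 0" "int_energy M WL > 0" "int_energy M WR > 0"
    using assms(3,4,11,12) equilibrium_state_admissible by simp_all
  have rho: "rho_Lstar M \<rho>bar WL WR > 0" "rho_Rstar M \<rho>bar WL WR > 0"
    using assms(1,5,6,8,9,13,14) speeds by (simp_all add: rho_Lstar_pos rho_Rstar_pos)
  have e: "e_Lstar M \<rho>bar WL WR > 0" "e_Rstar M \<rho>bar WL WR > 0"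
    \<comment> \<open>After rewriting with \<open>speeds\<close>, both sides agree literally,
      including the value 0 of the last term when a = b.\<close>
    using assms(15,16) unfolding e_Lstar_def e_Rstar_def speeds by blast+
  show ?thesis
    using rho e riemann_solver_admissible[OF adm rho e] by blast
qed

end
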